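(* Let $F$ be a field, let $A$ be a finitely generated torsion-free abelian group, and let $\mathcal A = F \ast A$ be a twisted group algebra of $A$ over $F$. Let $B$ be a subgroup of $A$ such that $A/B$ is infinite cyclic, and let $\mathcal B = F \ast B \subseteq \mathcal A$. Suppose that $\mathcal B$ is commutative and that $\mathcal A$ has center $F$. Then the following holds: if a simple $\mathcal A$-module $U$ is finitely generated as a $\mathcal B$-module, then $U$ is not $\mathcal B$-torsion.
   Context: A twisted group algebra $F \ast A$ of a finitely generated torsion-free abelian group $A$ over a field $F$ is an associative $A$-graded algebra $\bigoplus_{a \in A} F\bar a$ (so $\{\bar a : a \in A\}$ is an $F$-basis) with multiplication $\bar a_1 \bar a_2 = \lambda(a_1,a_2)\overline{a_1a_2}$, where $\lambda : A \times A \to F^* = F\setminus\{0\}$ satisfies the 2-cocycle condition $\lambda(a_1,a_2)\lambda(a_1a_2,a_3) = \lambda(a_2,a_3)\lambda(a_1,a_2a_3)$ for all $a_1,a_2,a_3 \in A$. For a subgroup $B \le A$, $F \ast B = \bigoplus_{b\in B} F\bar b$ is the subalgebra of elements supported in $B$. Modules are right modules. $S = \mathcal B \setminus\{0\}$ is an Ore set (in $\mathcal B$, which is a domain, and in $\mathcal A$). A module is $\mathcal B$-torsion if each of its elements is annihilated by some element of $\mathcal B\setminus\{0\}$. *)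

theory Defs
  imports "HOL-Algebra.Algebra"
begin

definition torsion_free_group :: "('a, 'm) monoid_scheme \<Rightarrow> bool" where
  "torsion_free_group G \<longleftrightarrow>
     (\<forall>x \<in> carrier G. \<forall>n::nat. n > 0 \<longrightarrow> x [^]\<^bsub>G\<^esub> n = \<one>\<^bsub>G\<^esub> \<longrightarrow> x = \<one>\<^bsub>G\<^esub>)"

definition finitely_generated_group :: "('a, 'm) monoid_scheme \<Rightarrow> bool" where
  "finitely_generated_group G \<longleftrightarrow>
     (\<exists>S. finite S \<and> S \<subseteq> carrier G \<and> generate G S = carrier G)"

definition two_cocycle ::
  "('f, 'r) ring_scheme \<Rightarrow> ('a, 'm) monoid_scheme \<Rightarrow> ('a \<Rightarrow> 'a \<Rightarrow> 'f) \<Rightarrow> bool" where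
  "two_cocycle F A \<Lambda> \<longleftrightarrow>
     (\<forall>a \<in> carrier A. \<forall>b \<in> carrier A. \<Lambda> a b \<in> carrier F - {\<zero>\<^bsub>F\<^esub>}) \<and>
     (\<forall>a \<in> carrier A. \<forall>b \<in> carrier A. \<forall>c \<in> carrier A.
        \<Lambda> a b \<otimes>\<^bsub>F\<^esub> \<Lambda> (a \<otimes>\<^bsub>A\<^esub> b) c = \<Lambda> b c \<otimes>\<^bsub>F\<^esub> \<Lambda> a (b \<otimes>\<^bsub>A\<^esub> c))"

definition coeff_support :: "('f, 'r) ring_scheme \<Rightarrow> ('a \<Rightarrow> 'f) \<Rightarrow> 'a set" where
  "coeff_support F f = {a. f a \<noteq> \<zero>\<^bsub>F\<^esub>}"

text \<open>
  A coefficient function \<open>f\<close>, zero outside the carrier of \<open>A\<close>, stands for the element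
  \<open>\<Sum>\<^sub>a f a \<cdot> e\<^sub>a\<close>, where \<open>e\<^sub>a\<close> is the basis element of \<open>a\<close>. The product is the bilinear
  extension of \<open>e\<^sub>a \<cdot> e\<^sub>b = \<Lambda> a b \<cdot> e\<^sub>a\<^sub>b\<close>. The cocycle need not be
  normalised, so the identity is the inverse of \<open>\<Lambda> 1 1\<close> times \<open>e\<^sub>1\<close>, not \<open>e\<^sub>1\<close>.
\<close>

definition twisted_group_algebra ::
  "('f, 'r) ring_scheme \<Rightarrow> ('a, 'm) monoid_scheme \<Rightarrow> ('a \<Rightarrow> 'a \<Rightarrow> 'f) \<Rightarrow> ('a \<Rightarrow> 'f) ring" where
  "twisted_group_algebra F A \<Lambda> =
     \<lparr> carrier = {f. (\<forall>a. f a \<in> carrier F) \<and> coeff_support F f \<subseteq> carrier A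
                      \<and> finite (coeff_support F f)},
       monoid.mult = (\<lambda>f g c. \<Oplus>\<^bsub>F\<^esub>p \<in> {(a, b). a \<in> coeff_support F f \<and> b \<in> coeff_support F g
                                        \<and> a \<otimes>\<^bsub>A\<^esub> b = c}.
                 (f (fst p) \<otimes>\<^bsub>F\<^esub> g (snd p)) \<otimes>\<^bsub>F\<^esub> \<Lambda> (fst p) (snd p)),
       one = (\<lambda>a. if a = \<one>\<^bsub>A\<^esub> then inv\<^bsub>F\<^esub> (\<Lambda> \<one>\<^bsub>A\<^esub> \<one>\<^bsub>A\<^esub>) else \<zero>\<^bsub>F\<^esub>),
       ring.zero = (\<lambda>a. \<zero>\<^bsub>F\<^esub>),
       ring.add = (\<lambda>f g a. f a \<oplus>\<^bsub>F\<^esub> g a) \<rparr>"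

definition twisted_group_subalgebra ::
  "('f, 'r) ring_scheme \<Rightarrow> ('a, 'm) monoid_scheme \<Rightarrow> ('a \<Rightarrow> 'a \<Rightarrow> 'f) \<Rightarrow> 'a set
     \<Rightarrow> ('a \<Rightarrow> 'f) ring" where
  "twisted_group_subalgebra F A \<Lambda> B =
     (twisted_group_algebra F A \<Lambda>)
       \<lparr> carrier := {f \<in> carrier (twisted_group_algebra F A \<Lambda>). coeff_support F f \<subseteq> B} \<rparr>"

text \<open>The field \<open>F\<close> sits in the algebra as the set \<open>F \<cdot> 1\<close>.\<close>

definition base_field_image ::
  "('f, 'r) ring_scheme \<Rightarrow> ('a, 'm) monoid_scheme \<Rightarrow> ('a \<Rightarrow> 'a \<Rightarrow> 'f) \<Rightarrow> ('a \<Rightarrow> 'f) set" where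
  "base_field_image F A \<Lambda> =
     {(\<lambda>a. k \<otimes>\<^bsub>F\<^esub> \<one>\<^bsub>twisted_group_algebra F A \<Lambda>\<^esub> a) | k. k \<in> carrier F}"

definition ring_center :: "('a, 'r) ring_scheme \<Rightarrow> 'a set" where
  "ring_center R = {z \<in> carrier R. \<forall>x \<in> carrier R. z \<otimes>\<^bsub>R\<^esub> x = x \<otimes>\<^bsub>R\<^esub> z}"

text \<open>
  As in the library's theory of modules over commutative rings, the ring structure of the record
  is used only for its additive part.
\<close>

record ('r, 'm) right_module_rec = "'m ring" +
  ract :: "['m, 'r] \<Rightarrow> 'm" (infixl \<open>\<triangleleft>\<index>\<close> 70)

locale right_module = R?: ring R + M?: abelian_group M
  for R :: "('r, 's) ring_scheme" (structure) and M :: "('r, 'm, 'z) right_module_rec_scheme" (structure) +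
  assumes ract_closed [simp, intro]:
      "\<lbrakk>x \<in> carrier M; r \<in> carrier R\<rbrakk> \<Longrightarrow> x \<triangleleft>\<^bsub>M\<^esub> r \<in> carrier M"
    and ract_add_left:
      "\<lbrakk>x \<in> carrier M; y \<in> carrier M; r \<in> carrier R\<rbrakk> \<Longrightarrow>
        (x \<oplus>\<^bsub>M\<^esub> y) \<triangleleft>\<^bsub>M\<^esub> r = x \<triangleleft>\<^bsub>M\<^esub> r \<oplus>\<^bsub>M\<^esub> y \<triangleleft>\<^bsub>M\<^esub> r"
    and ract_add_right:
      "\<lbrakk>x \<in> carrier M; r \<in> carrier R; s \<in> carrier R\<rbrakk> \<Longrightarrow>
        x \<triangleleft>\<^bsub>M\<^esub> (r \<oplus>\<^bsub>R\<^esub> s) = x \<triangleleft>\<^bsub>M\<^esub> r \<oplus>\<^bsub>M\<^esub> x \<triangleleft>\<^bsub>M\<^esub> s"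
    and ract_assoc:
      "\<lbrakk>x \<in> carrier M; r \<in> carrier R; s \<in> carrier R\<rbrakk> \<Longrightarrow>
        x \<triangleleft>\<^bsub>M\<^esub> (r \<otimes>\<^bsub>R\<^esub> s) = (x \<triangleleft>\<^bsub>M\<^esub> r) \<triangleleft>\<^bsub>M\<^esub> s"
    and ract_one [simp]:
      "x \<in> carrier M \<Longrightarrow> x \<triangleleft>\<^bsub>M\<^esub> \<one>\<^bsub>R\<^esub> = x"

definition right_submodule ::
  "'m set \<Rightarrow> ('r, 's) ring_scheme \<Rightarrow> ('r, 'm, 'z) right_module_rec_scheme \<Rightarrow> bool" where
  "right_submodule N R M \<longleftrightarrow>
     subgroup N (add_monoid M) \<and> (\<forall>x \<in> N. \<forall>r \<in> carrier R. x \<triangleleft>\<^bsub>M\<^esub> r \<in> N)"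

definition simple_right_module ::
  "('r, 's) ring_scheme \<Rightarrow> ('r, 'm, 'z) right_module_rec_scheme \<Rightarrow> bool" where
  "simple_right_module R M \<longleftrightarrow>
     right_module R M \<and> carrier M \<noteq> {\<zero>\<^bsub>M\<^esub>} \<and>
     (\<forall>N. right_submodule N R M \<longrightarrow> N = {\<zero>\<^bsub>M\<^esub>} \<or> N = carrier M)"

text \<open>
  The next two notions are also applied with \<open>R\<close> a subring of the ring over which \<open>M\<close> is
  given, which amounts to restricting scalars.
\<close>

definition finitely_generated_right_module ::
  "('r, 's) ring_scheme \<Rightarrow> ('r, 'm, 'z) right_module_rec_scheme \<Rightarrow> bool" where
  "finitely_generated_right_module R M \<longleftrightarrow>
     (\<exists>S. finite S \<and> S \<subseteq> carrier M \<and>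
        (\<forall>x \<in> carrier M. \<exists>c \<in> S \<rightarrow> carrier R. x = (\<Oplus>\<^bsub>M\<^esub>s \<in> S. s \<triangleleft>\<^bsub>M\<^esub> c s)))"

definition torsion_right_module ::
  "('r, 's) ring_scheme \<Rightarrow> ('r, 'm, 'z) right_module_rec_scheme \<Rightarrow> bool" where
  "torsion_right_module R M \<longleftrightarrow>
     (\<forall>x \<in> carrier M. \<exists>r \<in> carrier R - {\<zero>\<^bsub>R\<^esub>}. x \<triangleleft>\<^bsub>M\<^esub> r = \<zero>\<^bsub>M\<^esub>)"

end

theory Submission
  imports Defs
begin

text \<open>
  If \<open>U\<close> were \<open>\<B>\<close>-torsion, then, \<open>\<B>\<close> being a commutative domain and \<open>U\<close> finitely generated
  over it, the annihilator of \<open>U\<close> in \<open>\<B>\<close> would be nonzero. Let \<open>f\<close> be a nonzero annihilating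
  element of minimal support, translated so that the support contains the identity, and let \<open>x\<close>
  generate \<open>A\<close> modulo \<open>B\<close>. The element \<open>e\<^sub>y (f e\<^sub>x - e\<^sub>x f)\<close>, where \<open>y\<close> is the inverse of \<open>x\<close>, lies
  in \<open>\<B>\<close>, annihilates \<open>U\<close> and has support inside that of \<open>f\<close> minus the identity, so it vanishes.
  Hence \<open>f\<close> commutes with \<open>e\<^sub>x\<close> and with \<open>\<B>\<close>, so it is central, that is, a nonzero scalar; but a
  nonzero scalar annihilates only the zero module. That \<open>\<B>\<close> is a domain follows because
  torsion-free abelian groups are orderable (by Zorn's lemma) and so have unique products.
\<close>

section \<open>Right modules: action on zero and on finite sums\<close>

lemma (in right_module) ract_zero_left:
  assumes "r \<in> carrier R"
  shows "\<zero>\<^bsub>M\<^esub> \<triangleleft>\<^bsub>M\<^esub> r = \<zero>\<^bsub>M\<^esub>"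
  using ract_add_left[of "\<zero>\<^bsub>M\<^esub>" "\<zero>\<^bsub>M\<^esub>" r] assms by simp

lemma (in right_module) ract_finsum_left:
  assumes "finite S" "f \<in> S \<rightarrow> carrier M" "r \<in> carrier R"
  shows "(\<Oplus>\<^bsub>M\<^esub>s \<in> S. f s) \<triangleleft>\<^bsub>M\<^esub> r = (\<Oplus>\<^bsub>M\<^esub>s \<in> S. f s \<triangleleft>\<^bsub>M\<^esub> r)"
  using assms
proof (induction rule: finite_induct)
  case empty
  then show ?case by (simp add: ract_zero_left)
next
  case (insert s S)
  then have "(\<Oplus>\<^bsub>M\<^esub>s \<in> S. f s) \<in> carrier M" by (intro M.finsum_closed) auto
  with insert show ?case
    by (simp add: ract_add_left Pi_iff)
qed

section \<open>Orders on torsion-free abelian groups, and unique products\<close>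

text \<open>In the abelian case \<open>P\<close> is the set of elements above the identity in a
  translation-invariant partial order, where a \<le> b means that b times the inverse of a lies in
  \<open>P\<close>. In this form, refining an order is enlarging a set, which suits Zorn's
  lemma.\<close>

definition positive_cone :: "('a, 'm) monoid_scheme \<Rightarrow> 'a set \<Rightarrow> bool" where
  "positive_cone G P \<longleftrightarrow>
     submonoid P G \<and> (\<forall>a \<in> P. inv\<^bsub>G\<^esub> a \<in> P \<longrightarrow> a = \<one>\<^bsub>G\<^esub>)"

text \<open>The set is the submonoid generated by \<open>P\<close> and \<open>a\<close>. If it
  contains y and its inverse, multiplying their two expressions puts a power of \<open>inv a\<close>
  into \<open>P\<close>; by \<open>no\<close> its exponent is 0, so y already lies in
  \<open>P\<close> together with its inverse.\<close>

lemma (in comm_group) positive_cone_extend: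
  assumes P: "positive_cone G P" and a: "a \<in> carrier G"
    and no: "\<And>n::nat. n > 0 \<Longrightarrow> inv a [^] n \<notin> P"
  shows "positive_cone G {p \<otimes> a [^] n | p n::nat. p \<in> P}"
proof -
  interpret P: submonoid P G using P by (simp add: positive_cone_def)
  have one: "\<one> = \<one> \<otimes> a [^] (0::nat)" by simp
  have inv_P: "p = \<one>" if "p \<in> P" "inv p \<in> P" for p
    using P that by (auto simp: positive_cone_def)
  show ?thesis
    unfolding positive_cone_def
  proof (intro conjI submonoid.intro ballI impI)
    show "{p \<otimes> a [^] n | p n::nat. p \<in> P} \<subseteq> carrier G" using a by auto
    show "\<one> \<in> {p \<otimes> a [^] n | p n::nat. p \<in> P}" using one P.one_closed by blast
  next
    fix y z assume "y \<in> {p \<otimes> a [^] n | p n::nat. p \<in> P}" "z \<in> {p \<otimes> a [^] n | p n::nat. p \<in> P}"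
    then obtain p q and n m :: nat
      where yz: "y = p \<otimes> a [^] n" "z = q \<otimes> a [^] m" and pq: "p \<in> P" "q \<in> P" by blast
    have "y \<otimes> z = (p \<otimes> q) \<otimes> a [^] (n + m)"
      using yz pq a by (simp add: nat_pow_mult [symmetric] m_ac)
    then show "y \<otimes> z \<in> {p \<otimes> a [^] n | p n::nat. p \<in> P}" using pq by blast
  next
    fix y assume "y \<in> {p \<otimes> a [^] n | p n::nat. p \<in> P}" "inv y \<in> {p \<otimes> a [^] n | p n::nat. p \<in> P}"
    then obtain p q and n m :: nat
      where yz: "y = p \<otimes> a [^] n" "inv y = q \<otimes> a [^] m" and pq: "p \<in> P" "q \<in> P" by blast
    have [simp]: "p \<in> carrier G" "q \<in> carrier G" using pq by auto
    have "\<one> = y \<otimes> inv y" using yz(1) a by simp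
    also have "\<dots> = (p \<otimes> q) \<otimes> a [^] (n + m)"
      unfolding yz(2) unfolding yz(1) using a by (simp add: nat_pow_mult [symmetric] m_ac)
    finally have prod: "(p \<otimes> q) \<otimes> a [^] (n + m) = \<one>" by simp
    then have "p \<otimes> q = inv (a [^] (n + m))"
      using a by (metis \<open>p \<in> carrier G\<close> \<open>q \<in> carrier G\<close> inv_equality m_closed nat_pow_closed)
    then have "p \<otimes> q = inv a [^] (n + m)" using a by (simp add: nat_pow_inv)
    moreover have "p \<otimes> q \<in> P" using pq by simp
    ultimately have "n + m = 0" using no[of "n + m"] by (metis gr0I)
    then have nm: "n = 0" "m = 0" by simp_all
    then have "p \<otimes> q = \<one>" using prod a by simp
    then have "inv p = q" by (simp add: inv_equality m_comm)
    then have "p = \<one>" using inv_P pq by simp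
    then show "y = \<one>" using yz nm by simp
  qed
qed

text \<open>A cone that is maximal under inclusion is total: an element incomparable with the
  identity could be adjoined, itself or its inverse, unless it had finite order.\<close>

lemma (in comm_group) exists_total_positive_cone:
  assumes tf: "torsion_free_group G"
  obtains P where "positive_cone G P" "\<And>a. a \<in> carrier G \<Longrightarrow> a \<in> P \<or> inv a \<in> P"
proof -
  let ?Cones = "{P. positive_cone G P}"
  have triv: "positive_cone G {\<one>}"
    unfolding positive_cone_def by (auto intro: submonoid.intro)
  have "\<exists>M \<in> ?Cones. \<forall>Y \<in> ?Cones. M \<subseteq> Y \<longrightarrow> Y = M"
  proof (rule subset_Zorn_nonempty)
    show "?Cones \<noteq> {}" using triv by blast
  next
    fix C assume ne: "C \<noteq> {}" and ch: "subset.chain ?Cones C"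
    have pc: "positive_cone G Y" if "Y \<in> C" for Y
      using ch that by (auto simp: subset.chain_def)
    then have sm: "submonoid Y G" if "Y \<in> C" for Y
      using that by (simp add: positive_cone_def)
    have both: "\<exists>Y \<in> C. y \<in> Y \<and> z \<in> Y" if "y \<in> \<Union>C" "z \<in> \<Union>C" for y z
      using that ch unfolding subset_chain_def by blast
    show "\<Union>C \<in> ?Cones"
      unfolding positive_cone_def mem_Collect_eq
    proof (intro conjI submonoid.intro ballI impI)
      show "\<Union>C \<subseteq> carrier G" using sm submonoid.subset by blast
      show "\<one> \<in> \<Union>C" using ne sm submonoid.one_closed by blast
    next
      fix y z assume "y \<in> \<Union>C" "z \<in> \<Union>C"
      then obtain Y where Y: "Y \<in> C" "y \<in> Y" "z \<in> Y" using both by blast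
      then show "y \<otimes> z \<in> \<Union>C" using submonoid.m_closed[OF sm[OF Y(1)] Y(2,3)] by blast
    next
      fix y assume "y \<in> \<Union>C" "inv y \<in> \<Union>C"
      then obtain Y where Y: "Y \<in> C" "y \<in> Y" "inv y \<in> Y" using both by blast
      then show "y = \<one>" using pc[OF Y(1)] unfolding positive_cone_def by blast
    qed
  qed
  then obtain P where P: "positive_cone G P"
    and max: "\<And>Q. positive_cone G Q \<Longrightarrow> P \<subseteq> Q \<Longrightarrow> Q = P" by blast
  interpret P: submonoid P G using P by (simp add: positive_cone_def)
  have pow_P: "p [^] n \<in> P" if "p \<in> P" for p and n :: nat
    using that by (induction n) auto
  \<comment> \<open>Otherwise adjoining \<open>a\<close> would give a cone that contains
    \<open>P\<close> and, by maximality, equals \<open>P\<close>, although \<open>a\<close> lies in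
    it and not in \<open>P\<close>.\<close>
  have power: "\<exists>n::nat. n > 0 \<and> inv a [^] n \<in> P" if a: "a \<in> carrier G" "a \<notin> P" for a
  proof (rule ccontr)
    assume "\<not> ?thesis"
    then have "positive_cone G {p \<otimes> a [^] n | p n::nat. p \<in> P}"
      using positive_cone_extend P a by blast
    moreover have "p \<in> {p \<otimes> a [^] n | p n::nat. p \<in> P}" if "p \<in> P" for p
    proof -
      have "p = p \<otimes> a [^] (0::nat)" using that by simp
      then show ?thesis using that by blast
    qed
    ultimately have eq: "{p \<otimes> a [^] n | p n::nat. p \<in> P} = P" using max by blast
    have "\<one> \<otimes> a [^] (1::nat) \<in> {p \<otimes> a [^] n | p n::nat. p \<in> P}"
      using P.one_closed by blast
    then have "\<one> \<otimes> a [^] (1::nat) \<in> P" unfolding eq .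
    then show False using a by simp
  qed
  have "a \<in> P \<or> inv a \<in> P" if a: "a \<in> carrier G" for a
  proof (rule ccontr)
    assume not: "\<not> ?thesis"
    obtain n :: nat where n: "n > 0" "inv a [^] n \<in> P" using power[of a] a not by blast
    obtain m :: nat where m: "m > 0" "a [^] m \<in> P" using power[of "inv a"] a not by auto
    \<comment> \<open>The common exponent \<open>m * n\<close> turns the two powers in
      \<open>P\<close> into an element and its inverse, which forces that element to be the
      identity.\<close>
    have "a [^] (m * n) \<in> P" using pow_P[OF m(2), of n] a by (simp add: nat_pow_pow)
    moreover have "inv (a [^] (m * n)) \<in> P"
      using pow_P[OF n(2), of m] a by (simp add: nat_pow_pow mult.commute nat_pow_inv)
    ultimately have "a [^] (m * n) = \<one>" using P by (simp add: positive_cone_def)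
    then have "a = \<one>" using tf a m n unfolding torsion_free_group_def by (metis mult_pos_pos)
    then show False using not by simp
  qed
  then show thesis using that P by blast
qed

text \<open>Take s and t to be the greatest elements of the two sets in a total order. If a b = s t,
  the quotients s/a and t/b both lie in the cone and are inverse to each other, so both are
  trivial.\<close>

lemma (in comm_group) unique_product:
  assumes tf: "torsion_free_group G"
    and S: "finite S" "S \<noteq> {}" "S \<subseteq> carrier G" and T: "finite T" "T \<noteq> {}" "T \<subseteq> carrier G"
  obtains s t where "s \<in> S" "t \<in> T"
    "\<And>a b. a \<in> S \<Longrightarrow> b \<in> T \<Longrightarrow> a \<otimes> b = s \<otimes> t \<Longrightarrow> a = s \<and> b = t"
proof -
  obtain P where P: "positive_cone G P" and tot: "\<And>a. a \<in> carrier G \<Longrightarrow> a \<in> P \<or> inv a \<in> P"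
    using exists_total_positive_cone[OF tf] by blast
  interpret P: submonoid P G using P by (simp add: positive_cone_def)
  have greatest: "\<exists>s \<in> Y. \<forall>a \<in> Y. s \<otimes> inv a \<in> P"
    if "finite Y" "Y \<noteq> {}" "Y \<subseteq> carrier G" for Y
    using that
  proof (induction rule: finite_ne_induct)
    case (singleton y)
    then show ?case by simp
  next
    case (insert y Y)
    then obtain s where s: "s \<in> Y" "\<forall>a \<in> Y. s \<otimes> inv a \<in> P" by auto
    have [simp]: "y \<in> carrier G" "s \<in> carrier G" using insert s by auto
    show ?case
    proof (cases "s \<otimes> inv y \<in> P")
      case True
      then show ?thesis using s by auto
    next
      case False
      then have ys: "y \<otimes> inv s \<in> P"
        using tot[of "s \<otimes> inv y"] by (simp add: inv_mult m_comm)
      have "y \<otimes> inv a \<in> P" if "a \<in> Y" for a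
      proof -
        have [simp]: "a \<in> carrier G" using that insert by auto
        \<comment> \<open>This is transitivity of the order: y is above s and s is above a.\<close>
        have "y \<otimes> inv a = (y \<otimes> inv s) \<otimes> (s \<otimes> inv a)"
          by (simp add: m_assoc) (simp add: m_assoc [symmetric])
        then show ?thesis using ys s that by simp
      qed
      then show ?thesis by auto
    qed
  qed
  obtain s where s: "s \<in> S" "\<forall>a \<in> S. s \<otimes> inv a \<in> P" using greatest S by blast
  obtain t where t: "t \<in> T" "\<forall>b \<in> T. t \<otimes> inv b \<in> P" using greatest T by blast
  have "a = s \<and> b = t" if ab: "a \<in> S" "b \<in> T" "a \<otimes> b = s \<otimes> t" for a b
  proof -
    have [simp]: "a \<in> carrier G" "b \<in> carrier G" "s \<in> carrier G" "t \<in> carrier G"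
      using ab s t S T by auto
    have "(s \<otimes> inv a) \<otimes> (t \<otimes> inv b) = (s \<otimes> t) \<otimes> inv (a \<otimes> b)"
      by (simp add: inv_mult m_ac)
    then have one: "(s \<otimes> inv a) \<otimes> (t \<otimes> inv b) = \<one>" using ab by simp
    then have "inv (s \<otimes> inv a) = t \<otimes> inv b"
      by (metis m_comm inv_equality m_closed inv_closed \<open>a \<in> carrier G\<close> \<open>b \<in> carrier G\<close>
          \<open>s \<in> carrier G\<close> \<open>t \<in> carrier G\<close>)
    then have "s \<otimes> inv a = \<one>" using P s t ab by (simp add: positive_cone_def)
    then have "s = a"
      by (metis inv_equality inv_inv inv_closed \<open>a \<in> carrier G\<close> \<open>s \<in> carrier G\<close>)
    then show ?thesis using ab(3) by simp
  qed
  then show thesis using that s t by blast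
qed

section \<open>Cocycle identities and commuting basis elements\<close>

locale twisted_algebra = F: field F + A: comm_group A
  for F :: "('f, 'x) ring_scheme" and A :: "('a, 'y) monoid_scheme" +
  fixes \<Lambda> :: "'a \<Rightarrow> 'a \<Rightarrow> 'f"
  assumes cocycle: "two_cocycle F A \<Lambda>"
begin

abbreviation "R \<equiv> twisted_group_algebra F A \<Lambda>"
abbreviation "subalg \<equiv> twisted_group_subalgebra F A \<Lambda>"
abbreviation "supp \<equiv> coeff_support F"

text \<open>The monomial with coefficient \<open>k\<close> at the basis element of \<open>a\<close>.
  Since the cocycle is not normalised, coefficient one at the group identity need not give the
  identity of the algebra.\<close>

definition single :: "'f \<Rightarrow> 'a \<Rightarrow> 'a \<Rightarrow> 'f" where
  "single k a = (\<lambda>c. if c = a then k else \<zero>\<^bsub>F\<^esub>)"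

lemma \<Lambda>_closed [simp]: "a \<in> carrier A \<Longrightarrow> b \<in> carrier A \<Longrightarrow> \<Lambda> a b \<in> carrier F"
  and \<Lambda>_nonzero [simp]: "a \<in> carrier A \<Longrightarrow> b \<in> carrier A \<Longrightarrow> \<Lambda> a b \<noteq> \<zero>\<^bsub>F\<^esub>"
  using cocycle by (auto simp: two_cocycle_def)

lemma \<Lambda>_assoc:
  "a \<in> carrier A \<Longrightarrow> b \<in> carrier A \<Longrightarrow> c \<in> carrier A \<Longrightarrow>
    \<Lambda> a b \<otimes>\<^bsub>F\<^esub> \<Lambda> (a \<otimes>\<^bsub>A\<^esub> b) c = \<Lambda> b c \<otimes>\<^bsub>F\<^esub> \<Lambda> a (b \<otimes>\<^bsub>A\<^esub> c)"
  using cocycle by (auto simp: two_cocycle_def)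

text \<open>Both sides equal the value of the cocycle at the pair of identities: use the cocycle
  condition at (1, 1, a) and at (a, 1, 1) and cancel.\<close>

lemma \<Lambda>_one_commute:
  assumes [simp]: "a \<in> carrier A"
  shows "\<Lambda> \<one>\<^bsub>A\<^esub> a = \<Lambda> a \<one>\<^bsub>A\<^esub>"
proof -
  have "\<Lambda> \<one>\<^bsub>A\<^esub> a = \<Lambda> \<one>\<^bsub>A\<^esub> \<one>\<^bsub>A\<^esub>"
    using \<Lambda>_assoc[of "\<one>\<^bsub>A\<^esub>" "\<one>\<^bsub>A\<^esub>" a] F.m_rcancel[of "\<Lambda> \<one>\<^bsub>A\<^esub> a" "\<Lambda> \<one>\<^bsub>A\<^esub> \<one>\<^bsub>A\<^esub>" "\<Lambda> \<one>\<^bsub>A\<^esub> a"]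
    by simp
  moreover have "\<Lambda> a \<one>\<^bsub>A\<^esub> = \<Lambda> \<one>\<^bsub>A\<^esub> \<one>\<^bsub>A\<^esub>"
    using \<Lambda>_assoc[of a "\<one>\<^bsub>A\<^esub>" "\<one>\<^bsub>A\<^esub>"] F.m_rcancel[of "\<Lambda> a \<one>\<^bsub>A\<^esub>" "\<Lambda> a \<one>\<^bsub>A\<^esub>" "\<Lambda> \<one>\<^bsub>A\<^esub> \<one>\<^bsub>A\<^esub>"]
    by simp
  ultimately show ?thesis by simp
qed

text \<open>The quotient of \<open>\<Lambda> b a\<close> by \<open>\<Lambda> a b\<close> is the
  commutator of two basis elements and is multiplicative in \<open>a\<close>; this is the case where
  the factor for \<open>a\<close> is trivial, written without division. The equivalence, rather than
  one implication, is what yields closure under inverses below.\<close>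

lemma \<Lambda>_commute_mult_iff:
  assumes [simp]: "b \<in> carrier A" "a \<in> carrier A" "c \<in> carrier A" and ba: "\<Lambda> b a = \<Lambda> a b"
  shows "\<Lambda> b (a \<otimes>\<^bsub>A\<^esub> c) = \<Lambda> (a \<otimes>\<^bsub>A\<^esub> c) b \<longleftrightarrow> \<Lambda> b c = \<Lambda> c b"
proof -
  have "\<Lambda> a c \<otimes>\<^bsub>F\<^esub> \<Lambda> b (a \<otimes>\<^bsub>A\<^esub> c) = \<Lambda> b a \<otimes>\<^bsub>F\<^esub> \<Lambda> (b \<otimes>\<^bsub>A\<^esub> a) c"
    by (simp add: \<Lambda>_assoc)
  also have "\<dots> = \<Lambda> a b \<otimes>\<^bsub>F\<^esub> \<Lambda> (a \<otimes>\<^bsub>A\<^esub> b) c" by (simp add: ba A.m_comm)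
  also have "\<dots> = \<Lambda> b c \<otimes>\<^bsub>F\<^esub> \<Lambda> a (c \<otimes>\<^bsub>A\<^esub> b)" by (simp add: \<Lambda>_assoc A.m_comm)
  finally have 1: "\<Lambda> a c \<otimes>\<^bsub>F\<^esub> \<Lambda> b (a \<otimes>\<^bsub>A\<^esub> c) = \<Lambda> b c \<otimes>\<^bsub>F\<^esub> \<Lambda> a (c \<otimes>\<^bsub>A\<^esub> b)" .
  have 2: "\<Lambda> a c \<otimes>\<^bsub>F\<^esub> \<Lambda> (a \<otimes>\<^bsub>A\<^esub> c) b = \<Lambda> c b \<otimes>\<^bsub>F\<^esub> \<Lambda> a (c \<otimes>\<^bsub>A\<^esub> b)"
    by (simp add: \<Lambda>_assoc)
  have "\<Lambda> b (a \<otimes>\<^bsub>A\<^esub> c) = \<Lambda> (a \<otimes>\<^bsub>A\<^esub> c) b \<longleftrightarrow>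
      \<Lambda> a c \<otimes>\<^bsub>F\<^esub> \<Lambda> b (a \<otimes>\<^bsub>A\<^esub> c) = \<Lambda> a c \<otimes>\<^bsub>F\<^esub> \<Lambda> (a \<otimes>\<^bsub>A\<^esub> c) b"
    by (subst F.m_lcancel) auto
  also have "\<dots> \<longleftrightarrow> \<Lambda> b c = \<Lambda> c b"
    unfolding 1 2 by (subst F.m_rcancel) auto
  finally show ?thesis .
qed

text \<open>These are the group elements whose basis elements commute with that of \<open>b\<close>.
  Closure follows from the multiplicativity of the commutator.\<close>

lemma \<Lambda>_commutant_subgroup:
  assumes [simp]: "b \<in> carrier A"
  shows "subgroup {a \<in> carrier A. \<Lambda> b a = \<Lambda> a b} A"
proof (rule A.subgroupI)
  show "{a \<in> carrier A. \<Lambda> b a = \<Lambda> a b} \<noteq> {}" using assms by (auto intro: exI[of _ b])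
next
  fix a assume "a \<in> {a \<in> carrier A. \<Lambda> b a = \<Lambda> a b}"
  then have a: "a \<in> carrier A" and ba: "\<Lambda> b a = \<Lambda> a b" by blast+
  \<comment> \<open>The product is the identity, so this is known; the equivalence then passes from
    the product to its second factor.\<close>
  have "\<Lambda> b (a \<otimes>\<^bsub>A\<^esub> inv\<^bsub>A\<^esub> a) = \<Lambda> (a \<otimes>\<^bsub>A\<^esub> inv\<^bsub>A\<^esub> a) b"
    using a \<Lambda>_one_commute[OF assms] by (simp only: A.r_inv)
  then show "inv\<^bsub>A\<^esub> a \<in> {a \<in> carrier A. \<Lambda> b a = \<Lambda> a b}"
    using \<Lambda>_commute_mult_iff[OF assms a A.inv_closed[OF a] ba] a by blast
next
  fix a c assume "a \<in> {a \<in> carrier A. \<Lambda> b a = \<Lambda> a b}" "c \<in> {a \<in> carrier A. \<Lambda> b a = \<Lambda> a b}"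
  then have a: "a \<in> carrier A" and c: "c \<in> carrier A"
    and ba: "\<Lambda> b a = \<Lambda> a b" and bc: "\<Lambda> b c = \<Lambda> c b" by blast+
  show "a \<otimes>\<^bsub>A\<^esub> c \<in> {a \<in> carrier A. \<Lambda> b a = \<Lambda> a b}"
    using iffD2[OF \<Lambda>_commute_mult_iff[OF assms a c ba] bc] a c by blast
qed auto

section \<open>Supports, coefficients and products in the twisted group algebra\<close>

lemma carrier_R_iff:
  "f \<in> carrier R \<longleftrightarrow> (\<forall>a. f a \<in> carrier F) \<and> supp f \<subseteq> carrier A \<and> finite (supp f)"
  by (simp add: twisted_group_algebra_def)

lemma in_supp_iff: "a \<in> supp f \<longleftrightarrow> f a \<noteq> \<zero>\<^bsub>F\<^esub>"
  by (simp add: coeff_support_def)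

lemma eval_closed [simp]: "f \<in> carrier R \<Longrightarrow> f a \<in> carrier F"
  by (simp add: carrier_R_iff)

lemma supp_closed: "f \<in> carrier R \<Longrightarrow> a \<in> supp f \<Longrightarrow> a \<in> carrier A"
  by (auto simp: carrier_R_iff)

lemma zero_R: "\<zero>\<^bsub>R\<^esub> = (\<lambda>a. \<zero>\<^bsub>F\<^esub>)"
  unfolding twisted_group_algebra_def ring_record_simps by (rule refl)

lemma supp_nonempty: "f \<noteq> \<zero>\<^bsub>R\<^esub> \<Longrightarrow> supp f \<noteq> {}"
  using in_supp_iff[of _ f] unfolding zero_R by blast

lemma add_R: "(f \<oplus>\<^bsub>R\<^esub> g) a = f a \<oplus>\<^bsub>F\<^esub> g a"
  unfolding twisted_group_algebra_def ring_record_simps by (rule refl)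

lemma one_R: "\<one>\<^bsub>R\<^esub> = single (inv\<^bsub>F\<^esub> (\<Lambda> \<one>\<^bsub>A\<^esub> \<one>\<^bsub>A\<^esub>)) \<one>\<^bsub>A\<^esub>"
  unfolding twisted_group_algebra_def single_def ring_record_simps by (rule refl)

lemma mult_R:
  "(f \<otimes>\<^bsub>R\<^esub> g) c =
    (\<Oplus>\<^bsub>F\<^esub>p \<in> {(a, b). a \<in> supp f \<and> b \<in> supp g \<and> a \<otimes>\<^bsub>A\<^esub> b = c}.
       (f (fst p) \<otimes>\<^bsub>F\<^esub> g (snd p)) \<otimes>\<^bsub>F\<^esub> \<Lambda> (fst p) (snd p))"
  unfolding twisted_group_algebra_def ring_record_simps by (rule refl)

lemma single_closed [simp]: "k \<in> carrier F \<Longrightarrow> a \<in> carrier A \<Longrightarrow> single k a \<in> carrier R"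
  by (auto simp: carrier_R_iff single_def coeff_support_def)

lemma supp_single: "supp (single k a) \<subseteq> {a}"
  by (auto simp: single_def coeff_support_def)

lemma supp_single_nonzero: "k \<noteq> \<zero>\<^bsub>F\<^esub> \<Longrightarrow> supp (single k a) = {a}"
  by (auto simp: single_def coeff_support_def)

lemma single_same [simp]: "single k a a = k"
  by (simp add: single_def)

lemma mult_eval_zero:
  assumes "\<And>a b. a \<in> supp f \<Longrightarrow> b \<in> supp g \<Longrightarrow> a \<otimes>\<^bsub>A\<^esub> b \<noteq> c"
  shows "(f \<otimes>\<^bsub>R\<^esub> g) c = \<zero>\<^bsub>F\<^esub>"
proof -
  have pairs: "{(a, b). a \<in> supp f \<and> b \<in> supp g \<and> a \<otimes>\<^bsub>A\<^esub> b = c} = {}" using assms by auto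
  show ?thesis unfolding mult_R pairs by simp
qed

lemma supp_mult: "supp (f \<otimes>\<^bsub>R\<^esub> g) \<subseteq> supp f <#>\<^bsub>A\<^esub> supp g"
proof
  fix c assume "c \<in> supp (f \<otimes>\<^bsub>R\<^esub> g)"
  then have "\<exists>a b. a \<in> supp f \<and> b \<in> supp g \<and> a \<otimes>\<^bsub>A\<^esub> b = c"
    using mult_eval_zero[of f g c] unfolding in_supp_iff[of c] by blast
  then show "c \<in> supp f <#>\<^bsub>A\<^esub> supp g" unfolding set_mult_def by blast
qed

text \<open>At most one pair contributes to the coefficient. The points \<open>s\<close> and
  \<open>t\<close> need not lie in the supports: if one does not, the sum is empty and the
  right-hand side vanishes as well.\<close>

lemma mult_eval_unique:
  assumes f: "f \<in> carrier R" and g: "g \<in> carrier R" and [simp]: "s \<in> carrier A" "t \<in> carrier A"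
    and uniq: "\<And>a b. a \<in> supp f \<Longrightarrow> b \<in> supp g \<Longrightarrow> a \<otimes>\<^bsub>A\<^esub> b = s \<otimes>\<^bsub>A\<^esub> t \<Longrightarrow> a = s \<and> b = t"
  shows "(f \<otimes>\<^bsub>R\<^esub> g) (s \<otimes>\<^bsub>A\<^esub> t) = (f s \<otimes>\<^bsub>F\<^esub> g t) \<otimes>\<^bsub>F\<^esub> \<Lambda> s t"
proof (cases "s \<in> supp f \<and> t \<in> supp g")
  case True
  then have pairs: "{(a, b). a \<in> supp f \<and> b \<in> supp g \<and> a \<otimes>\<^bsub>A\<^esub> b = s \<otimes>\<^bsub>A\<^esub> t} = {(s, t)}"
    using uniq by auto
  show ?thesis unfolding mult_R pairs using f g by simp
next
  case False
  then have "(f \<otimes>\<^bsub>R\<^esub> g) (s \<otimes>\<^bsub>A\<^esub> t) = \<zero>\<^bsub>F\<^esub>" using uniq by (intro mult_eval_zero) blast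
  moreover have "f s \<otimes>\<^bsub>F\<^esub> g t = \<zero>\<^bsub>F\<^esub>" using False f g by (auto simp: in_supp_iff)
  ultimately show ?thesis by simp
qed

lemma mult_single_eval:
  assumes f: "f \<in> carrier R" and [simp]: "k \<in> carrier F" "a \<in> carrier A" "b \<in> carrier A"
  shows "(f \<otimes>\<^bsub>R\<^esub> single k a) (b \<otimes>\<^bsub>A\<^esub> a) = (f b \<otimes>\<^bsub>F\<^esub> k) \<otimes>\<^bsub>F\<^esub> \<Lambda> b a"
proof -
  have "c = b \<and> d = a"
    if "c \<in> supp f" "d \<in> supp (single k a)" "c \<otimes>\<^bsub>A\<^esub> d = b \<otimes>\<^bsub>A\<^esub> a" for c d
    using that supp_single[of k a] supp_closed[OF f] by auto
  then show ?thesis using mult_eval_unique[OF f single_closed, of k a b a] by simp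
qed

lemma single_mult_eval:
  assumes f: "f \<in> carrier R" and [simp]: "k \<in> carrier F" "a \<in> carrier A" "b \<in> carrier A"
  shows "(single k a \<otimes>\<^bsub>R\<^esub> f) (a \<otimes>\<^bsub>A\<^esub> b) = (k \<otimes>\<^bsub>F\<^esub> f b) \<otimes>\<^bsub>F\<^esub> \<Lambda> a b"
proof -
  have "c = a \<and> d = b"
    if "c \<in> supp (single k a)" "d \<in> supp f" "c \<otimes>\<^bsub>A\<^esub> d = a \<otimes>\<^bsub>A\<^esub> b" for c d
    using that supp_single[of k a] supp_closed[OF f] by auto
  then show ?thesis using mult_eval_unique[OF single_closed f, of k a a b] by simp
qed

lemma single_mult_single:
  assumes [simp]: "k \<in> carrier F" "l \<in> carrier F" "a \<in> carrier A" "b \<in> carrier A"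
  shows "single k a \<otimes>\<^bsub>R\<^esub> single l b = single (k \<otimes>\<^bsub>F\<^esub> l \<otimes>\<^bsub>F\<^esub> \<Lambda> a b) (a \<otimes>\<^bsub>A\<^esub> b)"
proof
  fix c
  show "(single k a \<otimes>\<^bsub>R\<^esub> single l b) c = single (k \<otimes>\<^bsub>F\<^esub> l \<otimes>\<^bsub>F\<^esub> \<Lambda> a b) (a \<otimes>\<^bsub>A\<^esub> b) c"
  proof (cases "c = a \<otimes>\<^bsub>A\<^esub> b")
    case True
    then show ?thesis by (simp add: mult_single_eval)
  next
    case False
    then have "(single k a \<otimes>\<^bsub>R\<^esub> single l b) c = \<zero>\<^bsub>F\<^esub>"
      using supp_single[of k a] supp_single[of l b] by (intro mult_eval_zero) blast
    then show ?thesis using False by (simp add: single_def)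
  qed
qed

text \<open>As \<open>A\<close> is commutative, swapping the pairs is a bijection between the index
  sets of the two convolution sums, and by \<open>comm\<close> corresponding terms agree.\<close>

lemma mult_commute:
  assumes f: "f \<in> carrier R" and g: "g \<in> carrier R"
    and comm: "\<And>a b. a \<in> supp f \<Longrightarrow> b \<in> supp g \<Longrightarrow> \<Lambda> a b = \<Lambda> b a"
  shows "f \<otimes>\<^bsub>R\<^esub> g = g \<otimes>\<^bsub>R\<^esub> f"
proof
  fix c
  let ?P = "\<lambda>f g. {(a, b). a \<in> supp f \<and> b \<in> supp g \<and> a \<otimes>\<^bsub>A\<^esub> b = c}"
  let ?t = "\<lambda>f g p. (f (fst p) \<otimes>\<^bsub>F\<^esub> g (snd p)) \<otimes>\<^bsub>F\<^esub> \<Lambda> (fst p) (snd p)"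
  have P: "?P g f = prod.swap ` ?P f g"
    using supp_closed[OF f] supp_closed[OF g] by (auto simp: A.m_comm image_iff)
  have "(g \<otimes>\<^bsub>R\<^esub> f) c = (\<Oplus>\<^bsub>F\<^esub>p \<in> ?P f g. ?t g f (prod.swap p))"
    unfolding mult_R P using f g supp_closed[OF f] supp_closed[OF g]
    by (intro F.add.finprod_reindex) (auto intro!: F.m_closed \<Lambda>_closed)
  also have "\<dots> = (\<Oplus>\<^bsub>F\<^esub>p \<in> ?P f g. ?t f g p)"
  proof (rule F.add.finprod_cong')
    show "?t f g \<in> ?P f g \<rightarrow> carrier F"
      using f g supp_closed[OF f] supp_closed[OF g] by (auto intro!: F.m_closed \<Lambda>_closed)
  next
    fix p assume "p \<in> ?P f g"
    then obtain a b where "p = (a, b)" "\<Lambda> a b = \<Lambda> b a" using comm by blast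
    then show "?t g f (prod.swap p) = ?t f g p" using f g by (simp add: F.m_comm)
  qed simp
  finally show "(f \<otimes>\<^bsub>R\<^esub> g) c = (g \<otimes>\<^bsub>R\<^esub> f) c" by (simp add: mult_R)
qed

text \<open>A unique product of the two supports gives a coefficient consisting of a single term, a
  product of nonzero field elements.\<close>

lemma mult_nonzero:
  assumes tf: "torsion_free_group A" and f: "f \<in> carrier R" and g: "g \<in> carrier R"
    and nz: "f \<noteq> \<zero>\<^bsub>R\<^esub>" "g \<noteq> \<zero>\<^bsub>R\<^esub>"
  shows "f \<otimes>\<^bsub>R\<^esub> g \<noteq> \<zero>\<^bsub>R\<^esub>"
proof -
  obtain s t where st: "s \<in> supp f" "t \<in> supp g"
    and uniq: "\<And>a b. a \<in> supp f \<Longrightarrow> b \<in> supp g \<Longrightarrow> a \<otimes>\<^bsub>A\<^esub> b = s \<otimes>\<^bsub>A\<^esub> t \<Longrightarrow> a = s \<and> b = t"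
    using A.unique_product[OF tf, of "supp f" "supp g"] f g nz supp_nonempty
    unfolding carrier_R_iff by metis
  have [simp]: "s \<in> carrier A" "t \<in> carrier A" using st f g supp_closed by auto
  have "(f \<otimes>\<^bsub>R\<^esub> g) (s \<otimes>\<^bsub>A\<^esub> t) = (f s \<otimes>\<^bsub>F\<^esub> g t) \<otimes>\<^bsub>F\<^esub> \<Lambda> s t"
    using uniq by (intro mult_eval_unique f g) auto
  also have "\<dots> \<noteq> \<zero>\<^bsub>F\<^esub>" using st f g by (simp add: in_supp_iff F.integral_iff)
  finally show ?thesis by (auto simp: zero_R)
qed

section \<open>The subalgebra supported on a subgroup\<close>

lemma carrier_subalg_iff: "f \<in> carrier (subalg B) \<longleftrightarrow> f \<in> carrier R \<and> supp f \<subseteq> B"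
  by (simp add: twisted_group_subalgebra_def)

lemma mult_subalg: "f \<otimes>\<^bsub>subalg B\<^esub> g = f \<otimes>\<^bsub>R\<^esub> g"
  and zero_subalg: "\<zero>\<^bsub>subalg B\<^esub> = \<zero>\<^bsub>R\<^esub>"
  unfolding twisted_group_subalgebra_def by simp_all

text \<open>The support of a product lies in the product of the supports, hence in the subgroup. The
  hypothesis \<open>ring R\<close> is later read off from \<open>right_module R U\<close>, which
  includes it.\<close>

lemma subalg_mult_closed:
  assumes "ring R" "subgroup B A" "f \<in> carrier (subalg B)" "g \<in> carrier (subalg B)"
  shows "f \<otimes>\<^bsub>R\<^esub> g \<in> carrier (subalg B)"
proof -
  have "supp f <#>\<^bsub>A\<^esub> supp g \<subseteq> B"
    using assms subgroup.m_closed[OF assms(2)] unfolding carrier_subalg_iff set_mult_def by blast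
  then show ?thesis
    using assms supp_mult[of f g] ring.ring_simprules(5)[OF assms(1)] unfolding carrier_subalg_iff
    by blast
qed

text \<open>Compare the coefficients at the product of \<open>a\<close> and \<open>b\<close> in the
  two products of their basis elements.\<close>

lemma subalg_commute_imp_\<Lambda>_commute:
  assumes B: "subgroup B A"
    and comm: "\<forall>f \<in> carrier (subalg B). \<forall>g \<in> carrier (subalg B).
      f \<otimes>\<^bsub>subalg B\<^esub> g = g \<otimes>\<^bsub>subalg B\<^esub> f"
    and ab: "a \<in> B" "b \<in> B"
  shows "\<Lambda> a b = \<Lambda> b a"
proof -
  have [simp]: "a \<in> carrier A" "b \<in> carrier A" using subgroup.mem_carrier[OF B] ab by auto
  have "single \<one>\<^bsub>F\<^esub> c \<in> carrier (subalg B)" if "c \<in> B" for c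
    using that supp_single[of "\<one>\<^bsub>F\<^esub>" c] subgroup.mem_carrier[OF B]
    by (auto simp: carrier_subalg_iff)
  then have "single \<one>\<^bsub>F\<^esub> a \<otimes>\<^bsub>R\<^esub> single \<one>\<^bsub>F\<^esub> b = single \<one>\<^bsub>F\<^esub> b \<otimes>\<^bsub>R\<^esub> single \<one>\<^bsub>F\<^esub> a"
    using comm ab unfolding mult_subalg by blast
  then have "(single \<one>\<^bsub>F\<^esub> a \<otimes>\<^bsub>R\<^esub> single \<one>\<^bsub>F\<^esub> b) (a \<otimes>\<^bsub>A\<^esub> b) =
      (single \<one>\<^bsub>F\<^esub> b \<otimes>\<^bsub>R\<^esub> single \<one>\<^bsub>F\<^esub> a) (b \<otimes>\<^bsub>A\<^esub> a)"
    by (simp add: A.m_comm)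
  then show ?thesis by (simp add: mult_single_eval)
qed

section \<open>Annihilators in the subalgebra and their minimal elements\<close>

text \<open>Multiply nonzero annihilators of the finitely many generators. The product is nonzero
  because there are no zero divisors, and by commutativity it kills each generator and then every
  combination of them.\<close>

lemma torsion_fg_has_annihilator:
  assumes tf: "torsion_free_group A" and B: "subgroup B A"
    and comm: "\<forall>f \<in> carrier (subalg B). \<forall>g \<in> carrier (subalg B).
      f \<otimes>\<^bsub>subalg B\<^esub> g = g \<otimes>\<^bsub>subalg B\<^esub> f"
    and U: "right_module R U"
    and fg: "finitely_generated_right_module (subalg B) U"
    and tors: "torsion_right_module (subalg B) U"
  obtains f where "f \<in> carrier (subalg B)" "f \<noteq> \<zero>\<^bsub>R\<^esub>"
    "\<And>u. u \<in> carrier U \<Longrightarrow> u \<triangleleft>\<^bsub>U\<^esub> f = \<zero>\<^bsub>U\<^esub>"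
proof -
  interpret U: right_module R U by (rule U)
  have sub: "f \<in> carrier R" if "f \<in> carrier (subalg B)" for f
    using that by (simp add: carrier_subalg_iff)
  have comm': "f \<otimes>\<^bsub>R\<^esub> g = g \<otimes>\<^bsub>R\<^esub> f"
    if "f \<in> carrier (subalg B)" "g \<in> carrier (subalg B)" for f g
    using comm that by (simp add: mult_subalg)
  obtain S where S: "finite S" "S \<subseteq> carrier U"
    and gen: "\<And>x. x \<in> carrier U \<Longrightarrow>
      \<exists>c \<in> S \<rightarrow> carrier (subalg B). x = (\<Oplus>\<^bsub>U\<^esub>s \<in> S. s \<triangleleft>\<^bsub>U\<^esub> c s)"
    using fg unfolding finitely_generated_right_module_def by blast
  have "\<exists>f \<in> carrier (subalg B). f \<noteq> \<zero>\<^bsub>R\<^esub> \<and> (\<forall>s \<in> S. s \<triangleleft>\<^bsub>U\<^esub> f = \<zero>\<^bsub>U\<^esub>)"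
    using S
  proof (induction rule: finite_induct)
    case empty
    have "\<one>\<^bsub>A\<^esub> \<in> B" using subgroup.one_closed[OF B] .
    then have "single \<one>\<^bsub>F\<^esub> \<one>\<^bsub>A\<^esub> \<in> carrier (subalg B)"
      using supp_single[of "\<one>\<^bsub>F\<^esub>" "\<one>\<^bsub>A\<^esub>"] by (auto simp: carrier_subalg_iff)
    moreover have "single \<one>\<^bsub>F\<^esub> \<one>\<^bsub>A\<^esub> \<noteq> \<zero>\<^bsub>R\<^esub>"
      unfolding zero_R single_def by (metis F.one_not_zero)
    ultimately show ?case by blast
  next
    case (insert s S)
    then obtain f where f: "f \<in> carrier (subalg B)" "f \<noteq> \<zero>\<^bsub>R\<^esub>" "\<forall>s \<in> S. s \<triangleleft>\<^bsub>U\<^esub> f = \<zero>\<^bsub>U\<^esub>"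
      by auto
    obtain g where g: "g \<in> carrier (subalg B)" "g \<noteq> \<zero>\<^bsub>R\<^esub>" "s \<triangleleft>\<^bsub>U\<^esub> g = \<zero>\<^bsub>U\<^esub>"
      using tors insert.prems unfolding torsion_right_module_def zero_subalg by blast
    have "t \<triangleleft>\<^bsub>U\<^esub> (f \<otimes>\<^bsub>R\<^esub> g) = \<zero>\<^bsub>U\<^esub>" if "t \<in> S" for t
      using that f g insert.prems by (simp add: U.ract_assoc sub U.ract_zero_left subset_iff)
    \<comment> \<open>For a right action the left factor acts first, so on \<open>s\<close> the
      factors are exchanged to let \<open>g\<close> act first.\<close>
    moreover have "s \<triangleleft>\<^bsub>U\<^esub> (f \<otimes>\<^bsub>R\<^esub> g) = \<zero>\<^bsub>U\<^esub>"
      unfolding comm'[OF f(1) g(1)]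
      using f g insert.prems by (simp add: U.ract_assoc sub U.ract_zero_left)
    moreover have "f \<otimes>\<^bsub>R\<^esub> g \<noteq> \<zero>\<^bsub>R\<^esub>" using mult_nonzero[OF tf] f g sub by simp
    moreover have "f \<otimes>\<^bsub>R\<^esub> g \<in> carrier (subalg B)"
      using subalg_mult_closed[OF U.R.ring_axioms B] f g by simp
    ultimately show ?case by blast
  qed
  then obtain f where f: "f \<in> carrier (subalg B)" "f \<noteq> \<zero>\<^bsub>R\<^esub>" "\<forall>s \<in> S. s \<triangleleft>\<^bsub>U\<^esub> f = \<zero>\<^bsub>U\<^esub>" by blast
  have "u \<triangleleft>\<^bsub>U\<^esub> f = \<zero>\<^bsub>U\<^esub>" if u: "u \<in> carrier U" for u
  proof -
    obtain c where c: "c \<in> S \<rightarrow> carrier (subalg B)" and uc: "u = (\<Oplus>\<^bsub>U\<^esub>s \<in> S. s \<triangleleft>\<^bsub>U\<^esub> c s)"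
      using gen[OF u] by blast
    have cS: "s \<in> carrier U" "c s \<in> carrier (subalg B)" if "s \<in> S" for s using c S that by auto
    have "u \<triangleleft>\<^bsub>U\<^esub> f = (\<Oplus>\<^bsub>U\<^esub>s \<in> S. (s \<triangleleft>\<^bsub>U\<^esub> c s) \<triangleleft>\<^bsub>U\<^esub> f)"
      unfolding uc using cS f sub S by (intro U.ract_finsum_left) auto
    also have "\<dots> = (\<Oplus>\<^bsub>U\<^esub>s \<in> S. \<zero>\<^bsub>U\<^esub>)"
    proof (rule U.M.finsum_cong')
      fix s assume s: "s \<in> S"
      \<comment> \<open>Commutativity moves \<open>f\<close> past the coefficient, so that it meets
        the generator it kills.\<close>
      have "(s \<triangleleft>\<^bsub>U\<^esub> c s) \<triangleleft>\<^bsub>U\<^esub> f = (s \<triangleleft>\<^bsub>U\<^esub> f) \<triangleleft>\<^bsub>U\<^esub> c s"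
        using cS[OF s] f(1) sub comm' by (simp add: U.ract_assoc [symmetric])
      then show "(s \<triangleleft>\<^bsub>U\<^esub> c s) \<triangleleft>\<^bsub>U\<^esub> f = \<zero>\<^bsub>U\<^esub>" using f s cS[OF s] sub by (simp add: U.ract_zero_left)
    qed auto
    finally show ?thesis by simp
  qed
  then show thesis using that f by blast
qed

text \<open>The commutator of \<open>f\<close> with the basis element of \<open>x\<close>, shifted
  back into the subalgebra, annihilates \<open>U\<close> and has lost the identity from its support.
  By minimality it is zero, and its coefficient at \<open>b\<close> gives the claim.\<close>

lemma minimal_annihilator_commutes:
  assumes U: "right_module R U" and B: "subgroup B A" and x: "x \<in> carrier A"
    and f: "f \<in> carrier (subalg B)" and ann: "\<And>u. u \<in> carrier U \<Longrightarrow> u \<triangleleft>\<^bsub>U\<^esub> f = \<zero>\<^bsub>U\<^esub>"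
    and one: "\<one>\<^bsub>A\<^esub> \<in> supp f"
    and min: "\<And>g. g \<in> carrier (subalg B) \<Longrightarrow> (\<And>u. u \<in> carrier U \<Longrightarrow> u \<triangleleft>\<^bsub>U\<^esub> g = \<zero>\<^bsub>U\<^esub>) \<Longrightarrow>
      card (supp g) < card (supp f) \<Longrightarrow> g = \<zero>\<^bsub>R\<^esub>"
    and b: "b \<in> supp f"
  shows "\<Lambda> b x = \<Lambda> x b"
proof -
  interpret U: right_module R U by (rule U)
  note [simp] = x
  have fR [simp]: "f \<in> carrier R" and fB: "supp f \<subseteq> B" using f by (auto simp: carrier_subalg_iff)
  \<comment> \<open>The sign of the commutator is carried by \<open>?e'\<close>. The factor
    \<open>?d\<close> moves the support from the coset of \<open>x\<close> back to
    \<open>B\<close>.\<close>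
  let ?e = "single \<one>\<^bsub>F\<^esub> x" and ?e' = "single (\<ominus>\<^bsub>F\<^esub> \<one>\<^bsub>F\<^esub>) x" and ?d = "single \<one>\<^bsub>F\<^esub> (inv\<^bsub>A\<^esub> x)"
  define h where "h = f \<otimes>\<^bsub>R\<^esub> ?e \<oplus>\<^bsub>R\<^esub> ?e' \<otimes>\<^bsub>R\<^esub> f"
  define g where "g = ?d \<otimes>\<^bsub>R\<^esub> h"
  have hR [simp]: "h \<in> carrier R" by (simp add: h_def)
  have h: "h (x \<otimes>\<^bsub>A\<^esub> c) = f c \<otimes>\<^bsub>F\<^esub> (\<Lambda> c x \<ominus>\<^bsub>F\<^esub> \<Lambda> x c)" if [simp]: "c \<in> carrier A" for c
  proof -
    have "(f \<otimes>\<^bsub>R\<^esub> ?e) (x \<otimes>\<^bsub>A\<^esub> c) = f c \<otimes>\<^bsub>F\<^esub> \<Lambda> c x"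
      using mult_single_eval[of f "\<one>\<^bsub>F\<^esub>" x c] by (simp add: A.m_comm)
    moreover have "(?e' \<otimes>\<^bsub>R\<^esub> f) (x \<otimes>\<^bsub>A\<^esub> c) = \<ominus>\<^bsub>F\<^esub> (f c \<otimes>\<^bsub>F\<^esub> \<Lambda> x c)"
      using single_mult_eval[of f "\<ominus>\<^bsub>F\<^esub> \<one>\<^bsub>F\<^esub>" x c] by (simp add: F.l_minus)
    ultimately show ?thesis
      by (simp add: h_def add_R F.minus_eq F.r_distr F.r_minus)
  qed
  \<comment> \<open>The last factor, due to the shift, is nonzero; only the first two decide whether
    the coefficient vanishes, and the second does so at the identity.\<close>
  have g: "g c = f c \<otimes>\<^bsub>F\<^esub> (\<Lambda> c x \<ominus>\<^bsub>F\<^esub> \<Lambda> x c) \<otimes>\<^bsub>F\<^esub> \<Lambda> (inv\<^bsub>A\<^esub> x) (x \<otimes>\<^bsub>A\<^esub> c)"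
    if [simp]: "c \<in> carrier A" for c
    using single_mult_eval[of h "\<one>\<^bsub>F\<^esub>" "inv\<^bsub>A\<^esub> x" "x \<otimes>\<^bsub>A\<^esub> c"]
    by (simp add: g_def h A.m_assoc [symmetric])
  have gR [simp]: "g \<in> carrier R" by (simp add: g_def)
  have "supp g \<subseteq> supp f - {\<one>\<^bsub>A\<^esub>}"
  proof
    fix c assume c: "c \<in> supp g"
    then have [simp]: "c \<in> carrier A" using supp_closed gR by blast
    have "f c \<noteq> \<zero>\<^bsub>F\<^esub>" using c by (auto simp: in_supp_iff g)
    moreover have "c \<noteq> \<one>\<^bsub>A\<^esub>" using c by (auto simp: in_supp_iff g \<Lambda>_one_commute[of x] F.minus_eq F.r_neg)
    ultimately show "c \<in> supp f - {\<one>\<^bsub>A\<^esub>}" by (simp add: in_supp_iff)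
  qed
  then have gB: "supp g \<subseteq> B" and "supp g \<subset> supp f" using fB one by auto
  then have card: "card (supp g) < card (supp f)"
    using fR by (simp add: carrier_R_iff psubset_card_mono)
  \<comment> \<open>Each summand of \<open>g\<close> has \<open>f\<close> as a factor, and
    \<open>f\<close> kills all of \<open>U\<close>, including whatever the factors before it
    produce.\<close>
  have "u \<triangleleft>\<^bsub>U\<^esub> g = \<zero>\<^bsub>U\<^esub>" if [simp]: "u \<in> carrier U" for u
    by (simp add: g_def h_def U.ract_assoc U.ract_add_right ann U.ract_zero_left)
  then have "g = \<zero>\<^bsub>R\<^esub>" using min card gB by (simp add: carrier_subalg_iff)
  moreover have [simp]: "b \<in> carrier A" using b fR supp_closed by blast
  ultimately have "f b \<otimes>\<^bsub>F\<^esub> (\<Lambda> b x \<ominus>\<^bsub>F\<^esub> \<Lambda> x b) \<otimes>\<^bsub>F\<^esub> \<Lambda> (inv\<^bsub>A\<^esub> x) (x \<otimes>\<^bsub>A\<^esub> b) = \<zero>\<^bsub>F\<^esub>"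
    using g[of b] by (simp add: zero_R)
  then have "\<Lambda> b x \<ominus>\<^bsub>F\<^esub> \<Lambda> x b = \<zero>\<^bsub>F\<^esub>"
    using b by (simp add: F.integral_iff in_supp_iff)
  then show ?thesis by simp
qed

text \<open>Choose an annihilator with the fewest support elements and multiply it by a monomial
  that moves one of these to the identity. This neither enlarges the support nor spoils
  annihilation, so minimality persists.\<close>

lemma obtain_minimal_annihilator:
  assumes U: "right_module R U" and B: "subgroup B A"
    and f0: "f0 \<in> carrier (subalg B)" "f0 \<noteq> \<zero>\<^bsub>R\<^esub>"
      "\<And>u. u \<in> carrier U \<Longrightarrow> u \<triangleleft>\<^bsub>U\<^esub> f0 = \<zero>\<^bsub>U\<^esub>"
  obtains f where "f \<in> carrier (subalg B)" "\<one>\<^bsub>A\<^esub> \<in> supp f"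
    "\<And>u. u \<in> carrier U \<Longrightarrow> u \<triangleleft>\<^bsub>U\<^esub> f = \<zero>\<^bsub>U\<^esub>"
    "\<And>g. g \<in> carrier (subalg B) \<Longrightarrow> (\<And>u. u \<in> carrier U \<Longrightarrow> u \<triangleleft>\<^bsub>U\<^esub> g = \<zero>\<^bsub>U\<^esub>) \<Longrightarrow>
      card (supp g) < card (supp f) \<Longrightarrow> g = \<zero>\<^bsub>R\<^esub>"
proof -
  interpret U: right_module R U by (rule U)
  interpret B: subgroup B A by (rule B)
  let ?I = "\<lambda>f. f \<in> carrier (subalg B) \<and> f \<noteq> \<zero>\<^bsub>R\<^esub> \<and> (\<forall>u \<in> carrier U. u \<triangleleft>\<^bsub>U\<^esub> f = \<zero>\<^bsub>U\<^esub>)"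
  obtain f where f: "?I f" and min: "\<And>g. ?I g \<Longrightarrow> card (supp f) \<le> card (supp g)"
    using ex_has_least_nat[of ?I f0 "\<lambda>f. card (supp f)"] f0 by blast
  have fR [simp]: "f \<in> carrier R" and fB: "supp f \<subseteq> B" using f by (auto simp: carrier_subalg_iff)
  obtain b where b: "b \<in> supp f" using f supp_nonempty by blast
  then have bB: "b \<in> B" using fB by blast
  then have [simp]: "b \<in> carrier A" by simp
  \<comment> \<open>The coefficient of \<open>f\<close> at \<open>b\<close> ends up, times a nonzero
    cocycle value, at the identity; hence the translate is nonzero too.\<close>
  let ?g = "f \<otimes>\<^bsub>R\<^esub> single \<one>\<^bsub>F\<^esub> (inv\<^bsub>A\<^esub> b)"
  have "single \<one>\<^bsub>F\<^esub> (inv\<^bsub>A\<^esub> b) \<in> carrier (subalg B)"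
    using supp_single[of "\<one>\<^bsub>F\<^esub>" "inv\<^bsub>A\<^esub> b"] bB by (auto simp: carrier_subalg_iff)
  then have gB: "?g \<in> carrier (subalg B)"
    using subalg_mult_closed[OF U.R.ring_axioms B] f by blast
  have "?g \<one>\<^bsub>A\<^esub> = f b \<otimes>\<^bsub>F\<^esub> \<Lambda> b (inv\<^bsub>A\<^esub> b)"
    using mult_single_eval[of f "\<one>\<^bsub>F\<^esub>" "inv\<^bsub>A\<^esub> b" b] by simp
  then have one: "\<one>\<^bsub>A\<^esub> \<in> supp ?g" using b by (simp add: in_supp_iff F.integral_iff)
  have ann: "u \<triangleleft>\<^bsub>U\<^esub> ?g = \<zero>\<^bsub>U\<^esub>" if "u \<in> carrier U" for u
    using that f by (simp add: U.ract_assoc U.ract_zero_left)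
  have fin: "finite (supp f)" using fR by (simp add: carrier_R_iff)
  have "supp ?g \<subseteq> (\<lambda>c. c \<otimes>\<^bsub>A\<^esub> inv\<^bsub>A\<^esub> b) ` supp f"
    using supp_mult[of f "single \<one>\<^bsub>F\<^esub> (inv\<^bsub>A\<^esub> b)"]
    by (auto simp: set_mult_def supp_single_nonzero)
  then have "card (supp ?g) \<le> card (supp f)" using fin surj_card_le by blast
  then have "g = \<zero>\<^bsub>R\<^esub>" if "g \<in> carrier (subalg B)" "\<And>u. u \<in> carrier U \<Longrightarrow> u \<triangleleft>\<^bsub>U\<^esub> g = \<zero>\<^bsub>U\<^esub>"
    "card (supp g) < card (supp ?g)" for g
    using min[of g] that by force
  then show thesis using that[OF gB one ann] by blast
qed

end

section \<open>Groups with a cyclic quotient\<close>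

text \<open>Every coset of \<open>B\<close> is that of a power of \<open>x\<close>, so each group
  element is an element of \<open>B\<close> times such a power, and both factors lie in
  \<open>C\<close>.\<close>

lemma (in comm_group) subgroup_eq_carrier_if_Mod_cyclic:
  assumes B: "subgroup B G" and C: "subgroup C G" and BC: "B \<subseteq> C"
    and x: "x \<in> C" "carrier (G Mod B) = range (\<lambda>n::int. (B #> x) [^]\<^bsub>G Mod B\<^esub> n)"
  shows "C = carrier G"
proof
  interpret N: normal B G using B by (simp add: subgroup_imp_normal)
  interpret B: subgroup B G by (rule B)
  interpret C: subgroup C G by (rule C)
  have [simp]: "x \<in> carrier G" using x by simp
  show "C \<subseteq> carrier G" by (rule C.subset)
  show "carrier G \<subseteq> C"
  proof
    fix a assume a: "a \<in> carrier G"
    then have "B #> a \<in> carrier (G Mod B)" by (auto simp: carrier_FactGroup)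
    then obtain n :: int where "B #> a = (B #> x) [^]\<^bsub>G Mod B\<^esub> n" using x(2) by auto
    also have "\<dots> = B #> (x [^] n)"
      using group_hom.hom_int_pow[of G "G Mod B" "\<lambda>a. B #> a" x n]
        N.r_coset_hom_Mod N.factorgroup_is_group
      by (simp add: group_hom_def group_hom_axioms_def)
    finally have "a \<in> B #> (x [^] n)" using rcos_self[OF a B] by simp
    then obtain b where "b \<in> B" "a = b \<otimes> x [^] n" by (auto simp: r_coset_def)
    moreover have "x [^] n \<in> C" using x(1) C subgroup_int_pow_closed by blast
    ultimately show "a \<in> C" using BC by auto
  qed
qed

section \<open>Centrality of a minimal annihilator, and its invertibility\<close>

theorem proposition2p8:
  fixes F :: "('f, 'x) ring_scheme"
    and A :: "('a, 'y) monoid_scheme"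
    and \<Lambda> :: "'a \<Rightarrow> 'a \<Rightarrow> 'f"
    and B :: "'a set"
    and U :: "('a \<Rightarrow> 'f, 'u, 'z) right_module_rec_scheme"
  assumes "field F"
    and "comm_group A"
    and "finitely_generated_group A"
    and "torsion_free_group A"
    and "two_cocycle F A \<Lambda>"
    and "subgroup B A"
    and "cyclic_group (A Mod B)" and "infinite (carrier (A Mod B))"
    and "\<forall>f \<in> carrier (twisted_group_subalgebra F A \<Lambda> B).
           \<forall>g \<in> carrier (twisted_group_subalgebra F A \<Lambda> B).
             f \<otimes>\<^bsub>twisted_group_subalgebra F A \<Lambda> B\<^esub> g = g \<otimes>\<^bsub>twisted_group_subalgebra F A \<Lambda> B\<^esub> f"
    and "ring_center (twisted_group_algebra F A \<Lambda>) = base_field_image F A \<Lambda>"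
    and "simple_right_module (twisted_group_algebra F A \<Lambda>) U"
    and "finitely_generated_right_module (twisted_group_subalgebra F A \<Lambda> B) U"
  shows "\<not> torsion_right_module (twisted_group_subalgebra F A \<Lambda> B) U"
proof
  assume tors: "torsion_right_module (twisted_group_subalgebra F A \<Lambda> B) U"
  interpret twisted_algebra F A \<Lambda>
    using assms by (simp add: twisted_algebra_def twisted_algebra_axioms_def)
  have U: "right_module R U" and nontriv: "carrier U \<noteq> {\<zero>\<^bsub>U\<^esub>}"
    using assms by (auto simp: simple_right_module_def)
  interpret U: right_module R U by (rule U)
  interpret B: subgroup B A by fact
  interpret N: normal B A using assms(6) by (simp add: A.subgroup_imp_normal)
  obtain D where D: "D \<in> carrier (A Mod B)" "carrier (A Mod B) = range (\<lambda>n::int. D [^]\<^bsub>A Mod B\<^esub> n)"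
    using assms(7) group.cyclic_group[OF N.factorgroup_is_group] by auto
  then obtain x where x: "x \<in> carrier A" "D = B #>\<^bsub>A\<^esub> x"
    unfolding carrier_FactGroup by blast
  obtain f0 where "f0 \<in> carrier (subalg B)" "f0 \<noteq> \<zero>\<^bsub>R\<^esub>"
    "\<And>u. u \<in> carrier U \<Longrightarrow> u \<triangleleft>\<^bsub>U\<^esub> f0 = \<zero>\<^bsub>U\<^esub>"
    using torsion_fg_has_annihilator[OF assms(4,6,9) U assms(12) tors] by blast
  then obtain f where f: "f \<in> carrier (subalg B)" "\<one>\<^bsub>A\<^esub> \<in> supp f"
    "\<And>u. u \<in> carrier U \<Longrightarrow> u \<triangleleft>\<^bsub>U\<^esub> f = \<zero>\<^bsub>U\<^esub>"
    "\<And>g. g \<in> carrier (subalg B) \<Longrightarrow> (\<And>u. u \<in> carrier U \<Longrightarrow> u \<triangleleft>\<^bsub>U\<^esub> g = \<zero>\<^bsub>U\<^esub>) \<Longrightarrow>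
      card (supp g) < card (supp f) \<Longrightarrow> g = \<zero>\<^bsub>R\<^esub>"
    using obtain_minimal_annihilator[OF U assms(6), of f0] by metis
  have fR [simp]: "f \<in> carrier R" and fB: "supp f \<subseteq> B" using f by (auto simp: carrier_subalg_iff)
  \<comment> \<open>The group elements whose basis elements commute with that of \<open>b\<close>
    form a subgroup. It contains \<open>B\<close> by commutativity of the subalgebra and
    \<open>x\<close> by minimality of \<open>f\<close>, hence it is all of \<open>A\<close>.\<close>
  have comm: "\<Lambda> b a = \<Lambda> a b" if b: "b \<in> supp f" and a: "a \<in> carrier A" for a b
  proof -
    let ?C = "{a \<in> carrier A. \<Lambda> b a = \<Lambda> a b}"
    have bB: "b \<in> B" using b fB by blast
    have "subgroup ?C A" using bB by (intro \<Lambda>_commutant_subgroup) simp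
    moreover have "B \<subseteq> ?C"
      using subalg_commute_imp_\<Lambda>_commute[OF assms(6,9) bB] B.subset by blast
    moreover have "x \<in> ?C"
      using minimal_annihilator_commutes[OF U assms(6) x(1) f(1,3,2,4) b] x(1) by blast
    ultimately have "?C = carrier A"
      using A.subgroup_eq_carrier_if_Mod_cyclic[OF assms(6), of ?C x] D(2) unfolding x(2) by blast
    then show ?thesis using a by blast
  qed
  have "f \<in> ring_center R"
    unfolding ring_center_def
  proof (intro CollectI conjI ballI)
    fix g assume g: "g \<in> carrier R"
    show "f \<otimes>\<^bsub>R\<^esub> g = g \<otimes>\<^bsub>R\<^esub> f"
      by (rule mult_commute[OF fR g], rule comm) (use supp_closed[OF g] in blast)+
  qed (rule fR)
  then obtain k where k: "k \<in> carrier F" "f = (\<lambda>a. k \<otimes>\<^bsub>F\<^esub> \<one>\<^bsub>R\<^esub> a)"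
    using assms(10) unfolding base_field_image_def by auto
  let ?l = "\<Lambda> \<one>\<^bsub>A\<^esub> \<one>\<^bsub>A\<^esub>"
  have l: "?l \<in> carrier F" "inv\<^bsub>F\<^esub> ?l \<in> carrier F" "?l \<otimes>\<^bsub>F\<^esub> inv\<^bsub>F\<^esub> ?l = \<one>\<^bsub>F\<^esub>"
    by (simp_all add: F.field_Units)
  \<comment> \<open>The inverse of \<open>?l\<close> is the coefficient of the identity of the
    algebra, so this is the scalar \<open>k\<close> written as a monomial.\<close>
  have f_single: "f = single (k \<otimes>\<^bsub>F\<^esub> inv\<^bsub>F\<^esub> ?l) \<one>\<^bsub>A\<^esub>"
  proof
    fix a
    show "f a = single (k \<otimes>\<^bsub>F\<^esub> inv\<^bsub>F\<^esub> ?l) \<one>\<^bsub>A\<^esub> a"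
      using k(1) unfolding k(2) one_R single_def by simp
  qed
  have "f \<one>\<^bsub>A\<^esub> \<noteq> \<zero>\<^bsub>F\<^esub>" using f(2) by (simp add: in_supp_iff)
  then have "k \<noteq> \<zero>\<^bsub>F\<^esub>" unfolding f_single single_same using l(2) by force
  then have k': "inv\<^bsub>F\<^esub> k \<in> carrier F" "k \<otimes>\<^bsub>F\<^esub> inv\<^bsub>F\<^esub> k = \<one>\<^bsub>F\<^esub>"
    using k(1) by (simp_all add: F.field_Units)
  \<comment> \<open>This is the scalar inverse to \<open>k\<close>, embedded in the algebra.\<close>
  define g where "g = single (inv\<^bsub>F\<^esub> k \<otimes>\<^bsub>F\<^esub> inv\<^bsub>F\<^esub> ?l) \<one>\<^bsub>A\<^esub>"
  have g: "g \<in> carrier R" unfolding g_def using k' l by simp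
  \<comment> \<open>Multiplying the two monomials contributes one factor \<open>?l\<close>, which
    cancels one of its two inverses; the remaining one is the coefficient of the identity.\<close>
  have "(k \<otimes>\<^bsub>F\<^esub> inv\<^bsub>F\<^esub> ?l) \<otimes>\<^bsub>F\<^esub> (inv\<^bsub>F\<^esub> k \<otimes>\<^bsub>F\<^esub> inv\<^bsub>F\<^esub> ?l) \<otimes>\<^bsub>F\<^esub> ?l =
      (k \<otimes>\<^bsub>F\<^esub> inv\<^bsub>F\<^esub> k) \<otimes>\<^bsub>F\<^esub> (?l \<otimes>\<^bsub>F\<^esub> inv\<^bsub>F\<^esub> ?l) \<otimes>\<^bsub>F\<^esub> inv\<^bsub>F\<^esub> ?l"
    using k(1) k'(1) l(1,2) by (simp only: F.m_ac F.m_closed)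
  then have fg: "f \<otimes>\<^bsub>R\<^esub> g = \<one>\<^bsub>R\<^esub>"
    unfolding f_single g_def one_R
    using k(1) k' l by (simp add: single_mult_single)
  have "u = \<zero>\<^bsub>U\<^esub>" if u: "u \<in> carrier U" for u
  proof -
    \<comment> \<open>An invertible annihilator leaves only the zero module, which a simple module
      is not.\<close>
    have "u = (u \<triangleleft>\<^bsub>U\<^esub> f) \<triangleleft>\<^bsub>U\<^esub> g" using U.ract_assoc[OF u fR g] U.ract_one[OF u] by (simp only: fg)
    then show ?thesis using f(3)[OF u] U.ract_zero_left[OF g] by simp
  qed
  then show False using nontriv U.M.zero_closed by blast
qed

end
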